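(* The magnitude $|q|$ is a dual number for any dual quaternion $q \in \mathbb{DQ}$. If $q$ is appreciable, then $|q| = \sqrt{qq^*}$. Moreover, for any $p, q \in \mathbb{DQ}$: 1. $qq^* = q^*q$; 2. $|q| = |q^*|$; 3. $|q| \ge 0$ for all $q$, and $|q| = 0$ if and only if $q = 0$; 4. $|pq| = |p|\,|q|$; 5. $|p+q| \le |p| + |q|$.
   Context: Dual numbers: $\mathbb{D}$ is the set of $a = a_{st} + a_{\mathcal{I}}\epsilon$ with $a_{st}, a_{\mathcal{I}} \in \mathbb{R}$ and $\epsilon^2 = 0$, with componentwise addition and product $ab = a_{st}b_{st} + (a_{st}b_{\mathcal{I}} + a_{\mathcal{I}}b_{st})\epsilon$. Total order on $\mathbb{D}$: $a < b$ if $a_{st} < b_{st}$, or $a_{st} = b_{st}$ and $a_{\mathcal{I}} < b_{\mathcal{I}}$; $a \le b$ means $a<b$ or $a=b$. If $a\in\mathbb{D}$ has $a_{st} > 0$, then $\sqrt{a} = \sqrt{a_{st}} + \frac{a_{\mathcal{I}}}{2\sqrt{a_{st}}}\epsilon$; also $\sqrt{0}=0$. Quaternions: $\mathbb{Q}$ denotes the set of real (Hamilton) quaternions $q = q_0 + q_1\mathbf{i} + q_2\mathbf{j} + q_3\mathbf{k}$, with conjugate $q^* = q_0 - q_1\mathbf{i} - q_2\mathbf{j} - q_3\mathbf{k}$ and magnitude $|q| = \sqrt{q_0^2+q_1^2+q_2^2+q_3^2}$. Dual quaternions: $\mathbb{DQ}$ is the set of $q = q_{st} + q_{\mathcal{I}}\epsilon$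 with $q_{st}, q_{\mathcal{I}} \in \mathbb{Q}$ (standard and infinitesimal parts), where $\epsilon^2=0$ and $\epsilon$ commutes with quaternions; so $pq = p_{st}q_{st} + (p_{st}q_{\mathcal{I}} + p_{\mathcal{I}}q_{st})\epsilon$. The conjugate is $q^* = q_{st}^* + q_{\mathcal{I}}^*\epsilon$. $q$ is appreciable if $q_{st} \neq 0$. The magnitude of $q \in \mathbb{DQ}$ is $$|q| = |q_{st}| + \frac{q_{st}q_{\mathcal{I}}^* + q_{\mathcal{I}}q_{st}^*}{2|q_{st}|}\epsilon \ \text{ if } q_{st} \neq 0, \qquad |q| = |q_{\mathcal{I}}|\epsilon \ \text{ if } q_{st} = 0.$$ *)

theory Defs
  imports Complex_Main
begin

section \<open>Quaternions\<close>

datatype quat = Quat (q_re: real) (q_i: real) (q_j: real) (q_k: real)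

instantiation quat :: real_algebra_1
begin

definition zero_quat :: quat where "0 = Quat 0 0 0 0"

definition one_quat :: quat where "1 = Quat 1 0 0 0"

definition plus_quat :: "quat \<Rightarrow> quat \<Rightarrow> quat" where
  "p + q = Quat (q_re p + q_re q) (q_i p + q_i q) (q_j p + q_j q) (q_k p + q_k q)"

definition uminus_quat :: "quat \<Rightarrow> quat" where
  "- q = Quat (- q_re q) (- q_i q) (- q_j q) (- q_k q)"

definition minus_quat :: "quat \<Rightarrow> quat \<Rightarrow> quat" where
  "p - q = Quat (q_re p - q_re q) (q_i p - q_i q) (q_j p - q_j q) (q_k p - q_k q)"

definition times_quat :: "quat \<Rightarrow> quat \<Rightarrow> quat" where
  "p * q = Quat
     (q_re p * q_re q - q_i p * q_i q - q_j p * q_j q - q_k p * q_k q)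
     (q_re p * q_i q + q_i p * q_re q + q_j p * q_k q - q_k p * q_j q)
     (q_re p * q_j q - q_i p * q_k q + q_j p * q_re q + q_k p * q_i q)
     (q_re p * q_k q + q_i p * q_j q - q_j p * q_i q + q_k p * q_re q)"

definition scaleR_quat :: "real \<Rightarrow> quat \<Rightarrow> quat" where
  "r *\<^sub>R q = Quat (r * q_re q) (r * q_i q) (r * q_j q) (r * q_k q)"

instance
  by standard
    (simp_all add: zero_quat_def one_quat_def plus_quat_def uminus_quat_def minus_quat_def
      times_quat_def scaleR_quat_def algebra_simps)

end

lemma of_real_quat: "of_real r = Quat r 0 0 0"
  by (simp add: of_real_def scaleR_quat_def one_quat_def)

definition q_cnj :: "quat \<Rightarrow> quat" where
  "q_cnj q = Quat (q_re q) (- q_i q) (- q_j q) (- q_k q)"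

definition q_mag :: "quat \<Rightarrow> real" where
  "q_mag q = sqrt ((q_re q)\<^sup>2 + (q_i q)\<^sup>2 + (q_j q)\<^sup>2 + (q_k q)\<^sup>2)"


section \<open>Dual extension of a ring\<close>

text \<open>
  \<open>Dual a b\<close> stands for \<open>a + b \<epsilon>\<close>, where \<open>\<epsilon>\<close> is central and squares to \<open>0\<close>. The same
  construction gives the dual numbers (over the reals) and the dual quaternions
  (over the quaternions).
\<close>

datatype 'a dual = Dual (st_part: 'a) (inf_part: 'a)

type_synonym dual_number = "real dual"
type_synonym dual_quat = "quat dual"

instantiation dual :: (ring_1) ring_1
begin

definition zero_dual :: "'a dual" where "0 = Dual 0 0"

definition one_dual :: "'a dual" where "1 = Dual 1 0"

definition plus_dual :: "'a dual \<Rightarrow> 'a dual \<Rightarrow> 'a dual" where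
  "a + b = Dual (st_part a + st_part b) (inf_part a + inf_part b)"

definition uminus_dual :: "'a dual \<Rightarrow> 'a dual" where
  "- a = Dual (- st_part a) (- inf_part a)"

definition minus_dual :: "'a dual \<Rightarrow> 'a dual \<Rightarrow> 'a dual" where
  "a - b = Dual (st_part a - st_part b) (inf_part a - inf_part b)"

definition times_dual :: "'a dual \<Rightarrow> 'a dual \<Rightarrow> 'a dual" where
  "a * b = Dual (st_part a * st_part b) (st_part a * inf_part b + inf_part a * st_part b)"

instance
  by standard
    (simp_all add: zero_dual_def one_dual_def plus_dual_def uminus_dual_def minus_dual_def
      times_dual_def algebra_simps)

end

instance dual :: (comm_ring_1) comm_ring_1
  by standard (simp_all add: one_dual_def plus_dual_def times_dual_def algebra_simps)

instantiation dual :: (linorder) linorder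
begin

definition less_dual :: "'a dual \<Rightarrow> 'a dual \<Rightarrow> bool" where
  "a < b \<longleftrightarrow> st_part a < st_part b \<or> (st_part a = st_part b \<and> inf_part a < inf_part b)"

definition less_eq_dual :: "'a dual \<Rightarrow> 'a dual \<Rightarrow> bool" where
  "a \<le> b \<longleftrightarrow> a < b \<or> a = b" for a b :: "'a dual"

instance
  by standard (auto simp: less_dual_def less_eq_dual_def intro: dual.expand)

end

text \<open>
  The square root is only meaningful if the standard part is positive or the argument
  is \<open>0\<close>; elsewhere \<open>0\<close> is a dummy value.
\<close>

definition dual_sqrt :: "dual_number \<Rightarrow> dual_number" where
  "dual_sqrt a =
     (if 0 < st_part a
      then Dual (sqrt (st_part a)) (inf_part a / (2 * sqrt (st_part a)))
      else 0)"


section \<open>Dual quaternions\<close>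

definition dq_of_dual :: "dual_number \<Rightarrow> dual_quat" where
  "dq_of_dual a = Dual (of_real (st_part a)) (of_real (inf_part a))"

definition is_dual_number :: "dual_quat \<Rightarrow> bool" where
  "is_dual_number q \<longleftrightarrow> q \<in> range dq_of_dual"

lemma inj_dq_of_dual: "inj dq_of_dual"
  by (auto intro!: injI simp: dq_of_dual_def dual.expand)

text \<open>
  The dual number that a dual quaternion is, meaningful only if \<^const>\<open>is_dual_number\<close> holds.
\<close>

definition dual_of_dq :: "dual_quat \<Rightarrow> dual_number" where
  "dual_of_dq = inv dq_of_dual"

lemma dual_of_dq_of_dual: "dual_of_dq (dq_of_dual a) = a"
  by (simp add: dual_of_dq_def inj_dq_of_dual)

definition dq_cnj :: "dual_quat \<Rightarrow> dual_quat" where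
  "dq_cnj q = Dual (q_cnj (st_part q)) (q_cnj (inf_part q))"

definition appreciable :: "dual_quat \<Rightarrow> bool" where
  "appreciable q \<longleftrightarrow> st_part q \<noteq> 0"

text \<open>
  The infinitesimal part of the magnitude is a priori a quaternion, so the magnitude is
  defined as a dual quaternion; that it is a dual number is something to be proved.
\<close>

definition dq_mag :: "dual_quat \<Rightarrow> dual_quat" where
  "dq_mag q =
     (if st_part q \<noteq> 0
      then Dual (of_real (q_mag (st_part q)))
             ((st_part q * q_cnj (inf_part q) + inf_part q * q_cnj (st_part q))
                /\<^sub>R (2 * q_mag (st_part q)))
      else Dual 0 (of_real (q_mag (inf_part q))))"

end

theory Submission
  imports Defs "HOL-Analysis.Linear_Algebra"
begin

text \<open>
  Quaternions form a four-dimensional Euclidean space whose norm is the quaternion magnitude,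
  and polarizing \<open>a a\<^sup>* = \<bar>a\<bar>\<^sup>2\<close> gives \<open>a b\<^sup>* + b a\<^sup>* = 2 \<langle>a, b\<rangle>\<close>, a real number. Hence, for \<open>a \<noteq> 0\<close>,
  the magnitude of \<open>a + b \<epsilon>\<close> is the dual number \<open>\<bar>a\<bar> + (\<langle>a, b\<rangle> / \<bar>a\<bar>) \<epsilon>\<close>, and for \<open>a = 0\<close> it is \<open>\<bar>b\<bar> \<epsilon>\<close>.
  In both cases this is the expansion of \<open>\<bar>a + t b\<bar>\<close> to first order as \<open>t\<close> decreases to \<open>0\<close>,
  which is why the rules for the Euclidean norm are inherited, with the lexicographic order
  comparing such expansions. The proofs themselves are algebraic and take no limits.

  Likewise \<open>q q\<^sup>*\<close> and \<open>q\<^sup>* q\<close> are both the dual number \<open>\<bar>a\<bar>\<^sup>2 + 2 \<langle>a, b\<rangle> \<epsilon>\<close>, whose square root,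
  for \<open>a \<noteq> 0\<close>, is the magnitude. Multiplicativity holds because left and right multiplication by a quaternion
  \<open>a\<close> scale the inner product by \<open>\<bar>a\<bar>\<^sup>2\<close>. In the triangle inequality for \<open>a + b \<epsilon>\<close> and \<open>c + d \<epsilon>\<close>, the
  infinitesimal parts matter only if \<open>\<bar>a + c\<bar> = \<bar>a\<bar> + \<bar>c\<bar>\<close>. If moreover \<open>a\<close> and \<open>c\<close> are nonzero, then
  \<open>a\<close>, \<open>c\<close> and \<open>a + c\<close> all point in the same direction (lemma \<open>inner_div_norm_add\<close>), so the
  infinitesimal parts simply add up; if one of them vanishes, the Cauchy-Schwarz inequality
  or the triangle inequality for \<open>b\<close> and \<open>d\<close> decides.
\<close>

section \<open>The Euclidean space of quaternions\<close>

instantiation quat :: real_inner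
begin

definition inner_quat :: "quat \<Rightarrow> quat \<Rightarrow> real" where
  "inner_quat p q = q_re p * q_re q + q_i p * q_i q + q_j p * q_j q + q_k p * q_k q"

definition norm_quat :: "quat \<Rightarrow> real" where
  "norm_quat q = sqrt (inner q q)"

definition dist_quat :: "quat \<Rightarrow> quat \<Rightarrow> real" where
  "dist_quat p q = norm (p - q)"

definition sgn_quat :: "quat \<Rightarrow> quat" where
  "sgn_quat q = q /\<^sub>R norm q"

definition uniformity_quat :: "(quat \<times> quat) filter" where
  "uniformity_quat = (INF e\<in>{0<..}. principal {(p, q). dist p q < e})"

definition open_quat :: "quat set \<Rightarrow> bool" where
  "open_quat U \<longleftrightarrow> (\<forall>x\<in>U. \<forall>\<^sub>F (x', y) in uniformity. x' = x \<longrightarrow> y \<in> U)"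

instance
proof
  fix p q r :: quat and a :: real
  show "inner p q = inner q p"
    by (simp add: inner_quat_def mult.commute)
  show "inner (p + q) r = inner p r + inner q r"
    by (simp add: inner_quat_def plus_quat_def algebra_simps)
  show "inner (a *\<^sub>R p) q = a * inner p q"
    by (simp add: inner_quat_def scaleR_quat_def algebra_simps)
  show "0 \<le> inner p p"
    by (simp add: inner_quat_def)
  show "inner p p = 0 \<longleftrightarrow> p = 0"
    by (cases p) (auto simp: inner_quat_def zero_quat_def add_nonneg_eq_0_iff)
qed (fact dist_quat_def norm_quat_def sgn_quat_def uniformity_quat_def open_quat_def)+

end

lemma q_mag_eq_norm: "q_mag q = norm q"
  by (simp add: q_mag_def norm_quat_def inner_quat_def power2_eq_square)

lemma q_cnj_eq_zero_iff [simp]: "q_cnj q = 0 \<longleftrightarrow> q = 0"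
  by (cases q) (simp add: q_cnj_def zero_quat_def)

lemma inner_q_cnj [simp]: "inner (q_cnj p) (q_cnj q) = inner p q"
  by (simp add: inner_quat_def q_cnj_def)

lemma norm_q_cnj [simp]: "norm (q_cnj q) = norm q"
  by (simp add: norm_eq_sqrt_inner)

lemma mult_q_cnj: "q * q_cnj q = of_real (inner q q)"
  by (simp add: of_real_quat inner_quat_def times_quat_def q_cnj_def)

text \<open>
  The polarization of the identity above; it makes the infinitesimal parts of \<open>\<bar>q\<bar>\<close> and of
  \<open>q q\<^sup>*\<close> real.
\<close>

lemma mult_q_cnj_polar: "p * q_cnj q + q * q_cnj p = of_real (2 * inner p q)"
  by (simp add: of_real_quat inner_quat_def times_quat_def q_cnj_def plus_quat_def
      del: of_real_mult)

lemma q_cnj_mult: "q_cnj q * q = of_real (inner q q)"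
  by (simp add: of_real_quat inner_quat_def times_quat_def q_cnj_def)

lemma q_cnj_mult_polar: "q_cnj p * q + q_cnj q * p = of_real (2 * inner p q)"
  by (simp add: of_real_quat inner_quat_def times_quat_def q_cnj_def plus_quat_def
      del: of_real_mult)

text \<open>
  Multiplication by a fixed quaternion is a similarity of the Euclidean space. These two
  polarized forms of \<open>\<bar>a c\<bar> = \<bar>a\<bar> \<bar>c\<bar>\<close> control the infinitesimal part of the magnitude of a product.
\<close>

lemma inner_quat_mult_left: "inner (a * c) (a * d) = inner a a * inner c d" for a c d :: quat
  by (simp add: inner_quat_def times_quat_def algebra_simps)

lemma inner_quat_mult_right: "inner (a * c) (b * c) = inner a b * inner c c" for a b c :: quat
  by (simp add: inner_quat_def times_quat_def algebra_simps)

lemma norm_quat_mult: "norm (a * c) = norm a * norm c" for a c :: quat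
  by (simp add: norm_eq_sqrt_inner inner_quat_mult_left real_sqrt_mult)

lemma quat_mult_eq_0_iff: "a * c = 0 \<longleftrightarrow> a = 0 \<or> c = 0" for a c :: quat
  by (metis norm_quat_mult mult_eq_0_iff norm_eq_zero)

section \<open>The magnitude as a dual number\<close>

text \<open>
  The magnitude with real instead of quaternion parts, so that it can be compared in the
  order of the dual numbers without inverting the embedding \<^const>\<open>dq_of_dual\<close>.
\<close>

definition dual_mag :: "dual_quat \<Rightarrow> dual_number" where
  "dual_mag q =
     (if st_part q \<noteq> 0
      then Dual (norm (st_part q)) (inner (st_part q) (inf_part q) / norm (st_part q))
      else Dual 0 (norm (inf_part q)))"

lemma dq_of_dual_mult: "dq_of_dual (a * b) = dq_of_dual a * dq_of_dual b"
  by (simp add: dq_of_dual_def times_dual_def)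

lemma dq_mag_eq: "dq_mag q = dq_of_dual (dual_mag q)"
proof -
  have "of_real (2 * x) /\<^sub>R (2 * y) = (of_real (x / y) :: quat)" for x y :: real
    by (simp add: of_real_def field_simps)
  then show ?thesis
    by (simp add: dq_mag_def dual_mag_def dq_of_dual_def q_mag_eq_norm mult_q_cnj_polar
        del: of_real_mult)
qed

lemma dual_of_dq_mag: "dual_of_dq (dq_mag q) = dual_mag q"
  by (simp add: dq_mag_eq dual_of_dq_of_dual)

lemma dq_mult_cnj:
  "q * dq_cnj q = dq_of_dual (Dual (inner (st_part q) (st_part q)) (2 * inner (st_part q) (inf_part q)))"
  by (simp add: times_dual_def dq_cnj_def dq_of_dual_def mult_q_cnj mult_q_cnj_polar
      del: of_real_mult)

lemma dq_cnj_mult: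
  "dq_cnj q * q = dq_of_dual (Dual (inner (st_part q) (st_part q)) (2 * inner (st_part q) (inf_part q)))"
  by (simp add: times_dual_def dq_cnj_def dq_of_dual_def q_cnj_mult q_cnj_mult_polar
      del: of_real_mult)

lemma dual_mag_eq_sqrt:
  assumes "appreciable q"
  shows "dual_mag q = dual_sqrt (dual_of_dq (q * dq_cnj q))"
  using assms
  by (simp add: appreciable_def dual_mag_def dual_sqrt_def dq_mult_cnj dual_of_dq_of_dual
      norm_eq_sqrt_inner)

lemma dual_mag_cnj: "dual_mag (dq_cnj q) = dual_mag q"
  by (simp add: dual_mag_def dq_cnj_def)

lemma dual_mag_nonneg: "0 \<le> dual_mag q"
  by (auto simp: dual_mag_def less_eq_dual_def less_dual_def zero_dual_def)

lemma dual_mag_eq_zero_iff: "dual_mag q = 0 \<longleftrightarrow> q = 0"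
  by (cases q) (auto simp: dual_mag_def zero_dual_def)

text \<open>
  By the product rule, the infinitesimal part of \<open>(a + b \<epsilon>) (c + d \<epsilon>)\<close> is \<open>a d + b c\<close>. Its inner
  product with \<open>a c\<close> splits into two terms, each with a common factor that scales out.
\<close>

lemma dual_mag_mult: "dual_mag (p * q) = dual_mag p * dual_mag q"
proof -
  obtain a b c d where p: "p = Dual a b" and q: "q = Dual c d"
    by (metis dual.exhaust)
  show ?thesis
  proof (cases "a = 0 \<or> c = 0")
    case True
    \<comment> \<open>The standard part of the product vanishes, and at most one term of \<open>a d + b c\<close> survives.\<close>
    then show ?thesis
      by (auto simp: p q dual_mag_def times_dual_def norm_quat_mult)
  next
    case False
    have "inner (a * c) (a * d + b * c) = (norm a)\<^sup>2 * inner c d + inner a b * (norm c)\<^sup>2"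
      by (simp add: inner_add_right inner_quat_mult_left inner_quat_mult_right
          power2_norm_eq_inner)
    then have "inner (a * c) (a * d + b * c) / (norm a * norm c)
        = norm a * (inner c d / norm c) + inner a b / norm a * norm c"
      using False by (simp add: field_simps power2_eq_square)
    then show ?thesis
      using False
      by (simp add: p q dual_mag_def times_dual_def norm_quat_mult quat_mult_eq_0_iff)
  qed
qed

section \<open>The triangle inequality\<close>

text \<open>
  Equality in the triangle inequality forces \<open>a\<close> and \<open>c\<close> to be parallel with the same orientation,
  so \<open>a + c\<close> and \<open>a\<close> have the same unit vector, and each side is the component of \<open>x\<close> along it.
\<close>

lemma inner_div_norm_add:
  fixes a c x :: "'a::real_inner"
  assumes "a \<noteq> 0" "norm (a + c) = norm a + norm c"
  shows "inner (a + c) x / norm (a + c) = inner a x / norm a"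
proof -
  have "norm a *\<^sub>R c = norm c *\<^sub>R a"
    using assms(2) norm_triangle_eq by blast
  then have "norm a *\<^sub>R (a + c) = norm (a + c) *\<^sub>R a"
    by (simp add: assms(2) algebra_simps)
  then have "norm a * inner (a + c) x = norm (a + c) * inner a x"
    by (metis inner_scaleR_left)
  moreover have "norm a + norm c > 0"
    using assms(1) by (simp add: add_pos_nonneg)
  ultimately show ?thesis
    using assms by (simp add: field_simps)
qed

lemma inner_div_norm_le: "inner a x / norm a \<le> norm x" for a x :: "'a::real_inner"
  using norm_cauchy_schwarz[of a x] by (cases "a = 0") (simp_all add: field_simps)

lemma dual_le_iff: "a \<le> b \<longleftrightarrow> st_part a < st_part b \<or> (st_part a = st_part b \<and> inf_part a \<le> inf_part b)"
  for a b :: "'a::linorder dual"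
  by (cases a; cases b) (auto simp: less_eq_dual_def less_dual_def)

text \<open>
  If the standard parts satisfy the triangle inequality strictly, the lexicographic order
  is decided by them. Otherwise the first-order terms have to be compared.
\<close>

lemma dual_mag_triangle: "dual_mag (p + q) \<le> dual_mag p + dual_mag q"
proof -
  obtain a b c d where p: "p = Dual a b" and q: "q = Dual c d"
    by (metis dual.exhaust)
  have st: "st_part (dual_mag r) = norm (st_part r)" for r
    by (simp add: dual_mag_def)
  show ?thesis
  proof (cases "norm (a + c) = norm a + norm c")
    case False
    then have "norm (a + c) < norm a + norm c"
      using norm_triangle_ineq[of a c] by linarith
    then show ?thesis
      by (simp add: dual_le_iff st plus_dual_def p q)
  next
    case aligned: True
    have "inf_part (dual_mag (p + q)) \<le> inf_part (dual_mag p) + inf_part (dual_mag q)"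
    proof (cases "a = 0 \<or> c = 0")
      case True
      \<comment> \<open>If \<open>a = c = 0\<close>, this is the triangle inequality for \<open>b\<close> and \<open>d\<close>. If just one of \<open>a\<close> and \<open>c\<close>
        vanishes, its summand contributes at most its full norm to the component along the other.\<close>
      then show ?thesis
        using norm_triangle_ineq[of b d] inner_div_norm_le[of a d] inner_div_norm_le[of c b]
        by (auto simp: p q dual_mag_def plus_dual_def inner_add_right add_divide_distrib)
    next
      case False
      have "a + c \<noteq> 0"
        using aligned False by (smt (verit) norm_eq_zero norm_ge_zero)
      moreover have "inner (a + c) b / norm (a + c) = inner a b / norm a"
        using inner_div_norm_add[of a c b] aligned False by simp
      moreover have "inner (a + c) d / norm (a + c) = inner c d / norm c"
        using inner_div_norm_add[of c a d] aligned False by (simp add: add.commute)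
      ultimately show ?thesis
        using False by (simp add: p q dual_mag_def plus_dual_def inner_add_right add_divide_distrib)
    qed
    then show ?thesis
      using aligned by (simp add: dual_le_iff st plus_dual_def p q)
  qed
qed

theorem theorem5p1:
  fixes p q :: dual_quat
  shows "is_dual_number (dq_mag q)
    \<and> (appreciable q \<longrightarrow>
        is_dual_number (q * dq_cnj q) \<and> 0 < st_part (dual_of_dq (q * dq_cnj q)) \<and>
        dual_of_dq (dq_mag q) = dual_sqrt (dual_of_dq (q * dq_cnj q)))
    \<and> q * dq_cnj q = dq_cnj q * q
    \<and> dq_mag q = dq_mag (dq_cnj q)
    \<and> (0 \<le> dual_of_dq (dq_mag q) \<and> (dq_mag q = 0 \<longleftrightarrow> q = 0))
    \<and> dq_mag (p * q) = dq_mag p * dq_mag q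
    \<and> dual_of_dq (dq_mag (p + q)) \<le> dual_of_dq (dq_mag p) + dual_of_dq (dq_mag q)"
proof (intro conjI impI)
  show "is_dual_number (dq_mag q)"
    by (simp add: is_dual_number_def dq_mag_eq)
  show "is_dual_number (q * dq_cnj q)"
    by (simp add: is_dual_number_def dq_mult_cnj)
  show "q * dq_cnj q = dq_cnj q * q"
    by (simp add: dq_mult_cnj dq_cnj_mult)
  show "dq_mag q = dq_mag (dq_cnj q)"
    by (simp add: dq_mag_eq dual_mag_cnj)
  show "0 \<le> dual_of_dq (dq_mag q)"
    by (simp add: dual_of_dq_mag dual_mag_nonneg)
  show "dq_mag q = 0 \<longleftrightarrow> q = 0"
  proof -
    have "dq_of_dual 0 = 0"
      by (simp add: dq_of_dual_def zero_dual_def)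
    then show ?thesis
      by (metis dq_mag_eq dual_mag_eq_zero_iff dual_of_dq_of_dual)
  qed
  show "dq_mag (p * q) = dq_mag p * dq_mag q"
    by (simp add: dq_mag_eq dual_mag_mult dq_of_dual_mult)
  show "dual_of_dq (dq_mag (p + q)) \<le> dual_of_dq (dq_mag p) + dual_of_dq (dq_mag q)"
    by (simp add: dual_of_dq_mag dual_mag_triangle)
next
  assume "appreciable q"
  then show "0 < st_part (dual_of_dq (q * dq_cnj q))"
    by (simp add: appreciable_def dq_mult_cnj dual_of_dq_of_dual)
  show "dual_of_dq (dq_mag q) = dual_sqrt (dual_of_dq (q * dq_cnj q))"
    using \<open>appreciable q\<close> by (simp add: dual_of_dq_mag dual_mag_eq_sqrt)
qed

end
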